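(* Let $(d_1,d_2)\in\mathbb{N}^2$. For each $s\in\mathbb{N}$, let $\chi_{d_1,d_2}(s)$ be the number of points $(m,n)\in\mathbb{Z}^2$ for which the conditions $$(m,n)=\sum_{k=1}^s\big(f(-i_k),f(-i_k-1)\big),\quad \sum_{k=1}^s f(i_k-2)\le d_1,\quad \sum_{k=1}^s f(i_k-1)\le d_2$$ admit a solution in integers $0\le i_1\le\dots\le i_s$, and $s$ is maximal with this property. Then $$\chi_{d_1,d_2}(s)=\begin{cases}2\min\{d_1,d_2,s,d_1+d_2-s\}+1 & \text{if } 0\le s\le d_1+d_2,\\ 0 & \text{if } s>d_1+d_2.\end{cases}$$ Equivalently, with $\mathbf d=(d_1,d_2)$, the set $\{\alpha\in E_{\mathbf d}:\ s_{\mathbf d}(\alpha)=s\}$ has exactly this cardinality.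
   Context: $\mathbb{N}=\{0,1,2,\dots\}$. Let $f\colon\mathbb{Z}\to\mathbb{Z}$ be defined by $f(0)=f(1)=1$ and $f(i+2)=f(i+1)+f(i)$ for all $i\in\mathbb{Z}$. Empty sums are $0$. Let $\gamma=(1+\sqrt5)/2$ and $\mathbb{Z}[\gamma]=\mathbb{Z}\oplus\mathbb{Z}\gamma^{-1}$; one has $\gamma^{-i}=f(-i)+f(-i-1)\gamma^{-1}$. For $\mathbf d=(d_1,d_2)\in\mathbb{N}^2$, $E_{\mathbf d}$ denotes the set of $\alpha\in\mathbb{Z}[\gamma]$ such that $\alpha=\sum_{k=1}^s\gamma^{-i_k}$, $\sum_{k=1}^s f(i_k-2)\le d_1$ and $\sum_{k=1}^s f(i_k-1)\le d_2$ for some $s\in\mathbb{N}$ and integers $0\le i_1\le\dots\le i_s$; for $\alpha\in E_{\mathbf d}$, $s_{\mathbf d}(\alpha)$ is the largest such $s$. *)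

theory Defs
  imports Main
begin

fun fpos :: "nat \<Rightarrow> int" where
  "fpos 0 = 1"
| "fpos (Suc 0) = 1"
| "fpos (Suc (Suc n)) = fpos (Suc n) + fpos n"

text \<open>f on nonpositive arguments: fneg n = f(-n), obtained from f(i) = f(i+2) - f(i+1).\<close>
fun fneg :: "nat \<Rightarrow> int" where
  "fneg 0 = 1"
| "fneg (Suc 0) = 0"
| "fneg (Suc (Suc n)) = fneg n - fneg (Suc n)"

definition fib_ext :: "int \<Rightarrow> int" where
  "fib_ext i = (if 0 \<le> i then fpos (nat i) else fneg (nat (- i)))"

definition admits :: "nat \<Rightarrow> nat \<Rightarrow> nat \<Rightarrow> int \<times> int \<Rightarrow> bool" where
  "admits d1 d2 s p \<longleftrightarrow> (\<exists>is :: int list. length is = s \<and> sorted is \<and> (\<forall>i\<in>set is. 0 \<le> i) \<and>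
      p = (sum_list (map (\<lambda>i. fib_ext (- i)) is), sum_list (map (\<lambda>i. fib_ext (- i - 1)) is)) \<and>
      sum_list (map (\<lambda>i. fib_ext (i - 2)) is) \<le> int d1 \<and>
      sum_list (map (\<lambda>i. fib_ext (i - 1)) is) \<le> int d2)"

definition chi :: "nat \<Rightarrow> nat \<Rightarrow> nat \<Rightarrow> nat" where
  "chi d1 d2 s = card {p. admits d1 d2 s p \<and> (\<forall>t. admits d1 d2 t p \<longrightarrow> t \<le> s)}"

end

(* View the index sequences as multisets of naturals with two Fibonacci-type costs
   f(i - 2), f(i - 1). The exchanges that keep the value and do not raise the costs show that a
   point whose maximal size is s >= 1 is represented by a multiset of size s supported on a window
   {i, i+1, i+2} with i present; linear programming duality shows that such a representation is
   unique, and that the point has no larger affordable representation exactly when the exchange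
   {i} -> {i+1, i+2} is not affordable. It remains to count these windowed multisets. The map nxt,
   which replaces two copies of i by i and i+2, raises the cost by that of i+1, half the cost of the
   exchange, and preserves the number of odd indices. Its orbits show that
   min {d1, d2, s, d1+d2-s} + 1 affordable windowed multisets have an unaffordable image. The other
   ones to be counted are mapped by nxt injectively to these, missing exactly one. *)

theory Submission
  imports Defs "HOL-Library.Multiset"
begin

section \<open>Costs of indices and multisets of indices\<close>

text \<open>\<open>cst j\<close> is $f(j-2)$: the two costs of the index \<open>j\<close> are \<open>cst j\<close> and \<open>cst (Suc j)\<close>.\<close>

fun cst :: "nat \<Rightarrow> nat" where
  "cst 0 = 1"
| "cst (Suc 0) = 0"
| "cst (Suc (Suc n)) = cst n + cst (Suc n)"

lemma fib_ext_uminus: "fib_ext (- int j) = fneg j"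
  by (cases j) (auto simp: fib_ext_def nat_add_distrib)

lemma fib_ext_uminus_Suc: "fib_ext (- int j - 1) = fneg (Suc j)"
  using fib_ext_uminus[of "Suc j"] by (simp only: of_nat_Suc minus_add_distrib diff_conv_add_uminus add.commute)

lemma fpos_eq_cst: "fpos n = int (cst (Suc (Suc n)))"
  by (induction n rule: fpos.induct) auto

lemma fib_ext_minus_two: "fib_ext (int j - 2) = int (cst j)"
proof (cases j rule: cst.cases)
  case 1
  then show ?thesis using fib_ext_uminus[of 2] by (simp add: numeral_2_eq_2)
next
  case 2
  then show ?thesis using fib_ext_uminus[of 1] by simp
next
  case (3 n)
  then show ?thesis using fpos_eq_cst[of n] by (simp add: fib_ext_def)
qed

lemma fib_ext_minus_one: "fib_ext (int j - 1) = int (cst (Suc j))"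
  using fib_ext_minus_two[of "Suc j"] by (simp add: algebra_simps)

lemma cst_pos: "cst j + cst (Suc j) \<ge> 1"
  by (induction j) auto

lemma cst_Suc_Suc_pos: "cst (Suc (Suc j)) \<ge> 1"
  using cst_pos[of j] by simp

text \<open>A crude linear bound; it is only meant to make costs exceed any given budget.\<close>

lemma cst_ge: "cst (Suc (Suc (Suc (Suc j)))) \<ge> j"
proof (induction j)
  case (Suc j)
  then show ?case using cst_Suc_Suc_pos[of j] by simp
qed simp

abbreviation msum :: "(nat \<Rightarrow> int) \<Rightarrow> nat multiset \<Rightarrow> int" where
  "msum f M \<equiv> (\<Sum>j\<in>#M. f j)"

definition val :: "nat multiset \<Rightarrow> int \<times> int" where
  "val M = (msum fneg M, msum (\<lambda>j. fneg (Suc j)) M)"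

definition fits :: "nat \<Rightarrow> nat \<Rightarrow> nat multiset \<Rightarrow> bool" where
  "fits d1 d2 M \<longleftrightarrow> msum (\<lambda>j. int (cst j)) M \<le> int d1 \<and> msum (\<lambda>j. int (cst (Suc j))) M \<le> int d2"

lemma admits_iff:
  "admits d1 d2 s p \<longleftrightarrow> (\<exists>M. size M = s \<and> val M = p \<and> fits d1 d2 M)"
proof
  assume "admits d1 d2 s p"
  then obtain xs where xs: "length xs = s" "\<forall>i\<in>set xs. 0 \<le> i"
    "p = (sum_list (map (\<lambda>i. fib_ext (- i)) xs), sum_list (map (\<lambda>i. fib_ext (- i - 1)) xs))"
    "sum_list (map (\<lambda>i. fib_ext (i - 2)) xs) \<le> int d1"
    "sum_list (map (\<lambda>i. fib_ext (i - 1)) xs) \<le> int d2"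
    unfolding admits_def by blast
  have eq: "xs = map int (map nat xs)"
    using xs(2) by (induction xs) auto
  define js where "js = map nat xs"
  have sums: "sum_list (map F xs) = (\<Sum>j\<in>#mset js. F (int j))" for F :: "int \<Rightarrow> int"
    by (subst eq) (simp add: js_def[symmetric] sum_mset_sum_list[symmetric] multiset.map_comp o_def del: map_map)
  show "\<exists>M. size M = s \<and> val M = p \<and> fits d1 d2 M"
    using xs(1,3-5) unfolding sums
    by (intro exI[of _ "mset js"])
       (simp add: val_def fits_def fib_ext_uminus fib_ext_uminus_Suc fib_ext_minus_two
          fib_ext_minus_one js_def)
next
  assume "\<exists>M. size M = s \<and> val M = p \<and> fits d1 d2 M"
  then obtain M where M: "size M = s" "val M = p" "fits d1 d2 M" by blast
  define js where "js = sorted_list_of_multiset M"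
  have ms: "mset js = M" by (simp add: js_def)
  have sums: "sum_list (map F (map int js)) = (\<Sum>j\<in>#M. F (int j))" for F :: "int \<Rightarrow> int"
    by (simp add: ms[symmetric] sum_mset_sum_list[symmetric] multiset.map_comp o_def del: map_map)
  have srt: "sorted (map int js)"
    by (simp add: js_def sorted_map sorted_wrt_mono_rel[OF _ sorted_sorted_list_of_multiset])
  have len: "length (map int js) = s"
    using M(1) ms by (metis length_map size_mset)
  show "admits d1 d2 s p"
    unfolding admits_def
    by (rule exI[of _ "map int js"], unfold sums, intro conjI)
       (use M srt len in \<open>auto simp: val_def fits_def fib_ext_uminus fib_ext_uminus_Suc fib_ext_minus_two
          fib_ext_minus_one\<close>)
qed

section \<open>Linear programming bound for the costs\<close>

text \<open>The values at two consecutive indices form a basis of the integer lattice, so an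
  integral functional can be prescribed there. In the induction its value at \<open>i\<close> must
  be the sum of those at the next two indices.\<close>

lemma fneg_interpolate:
  "\<exists>a b. a * fneg i + b * fneg (Suc i) = X \<and> a * fneg (Suc i) + b * fneg (Suc (Suc i)) = Y"
proof (induction i arbitrary: X Y)
  case 0
  show ?case by (rule exI[of _ X], rule exI[of _ Y]) simp
next
  case (Suc i)
  from Suc[of "X + Y" X] obtain a b where
    ab: "a * fneg i + b * fneg (Suc i) = X + Y" "a * fneg (Suc i) + b * fneg (Suc (Suc i)) = X"
    by blast
  show ?case
    by (rule exI[of _ a], rule exI[of _ b]) (use ab in \<open>simp add: algebra_simps\<close>)
qed

text \<open>The dual solution: an affine function of the size and the value that minorises the cost of
  every index and agrees with it on the window. Its defect satisfies a four-term recurrence with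
  nonnegative growth on either side of the window.\<close>

lemma lp_certificate:
  fixes c :: "nat \<Rightarrow> int"
  assumes rec: "\<And>j. c (Suc (Suc j)) = c j + c (Suc j)" and nonneg: "\<And>j. c j \<ge> 0"
  obtains a b where
    "\<And>j. c j \<ge> 2 * c (Suc i) + a * fneg j + b * fneg (Suc j)"
    "\<And>j. j \<in> {i, Suc i, Suc (Suc i)} \<Longrightarrow> c j = 2 * c (Suc i) + a * fneg j + b * fneg (Suc j)"
    "\<And>j. (\<And>k. c k > 0) \<Longrightarrow> j \<notin> {i, Suc i, Suc (Suc i)} \<Longrightarrow>
       c j > 2 * c (Suc i) + a * fneg j + b * fneg (Suc j)"
proof -
  \<comment> \<open>These two values make the defect \<open>D\<close> below vanish at
    \<open>i\<close> and \<open>Suc i\<close>. The constant \<open>2 * c (Suc i)\<close>, the price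
    of exchanging \<open>i\<close> for the two next indices, then makes it vanish at
    \<open>Suc (Suc i)\<close> too.\<close>
  obtain a b where ab: "a * fneg i + b * fneg (Suc i) = c i - 2 * c (Suc i)"
    "a * fneg (Suc i) + b * fneg (Suc (Suc i)) = - c (Suc i)"
    using fneg_interpolate by blast
  define D where "D j = c j - (2 * c (Suc i) + a * fneg j + b * fneg (Suc j))" for j
  \<comment> \<open>Costs have characteristic polynomial x^2 - x - 1, values x^2 + x - 1; the
    product is x^4 - 3x^2 + 1. The last summand comes from the constant in \<open>D\<close>.\<close>
  have D4: "D (Suc (Suc (Suc (Suc j)))) = 3 * D (Suc (Suc j)) - D j + 2 * c (Suc i)" for j
    by (simp add: D_def rec algebra_simps)
  have D0: "D i = 0" and D1: "D (Suc i) = 0" using ab by (simp_all add: D_def)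
  have D2: "D (Suc (Suc i)) = 0" using ab by (simp add: D_def rec algebra_simps)
  have D3: "D (Suc (Suc (Suc i))) = 2 * c i" using ab by (simp add: D_def rec algebra_simps)
  have fwd: "D (i + n) \<ge> 0 \<and> D (i + Suc (Suc n)) \<ge> D (i + n)" for n
  proof (induction n rule: cst.induct)
    case (3 n)
    then show ?case using D4[of "i + n"] nonneg[of "Suc i"] by simp
  qed (use D0 D1 D2 D3 nonneg[of i] in auto)
  have fwd_pos: "D (i + Suc (Suc (Suc n))) > 0" if pos: "\<And>k. c k > 0" for n
  proof (induction n rule: cst.induct)
    case 1
    then show ?case using D3 pos[of i] by simp
  next
    case 2
    then show ?case using D4[of i] D0 D2 pos[of "Suc i"] by simp
  next
    case (3 n)
    then show ?case using fwd[of "Suc (Suc (Suc n))"] by simp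
  qed
  \<comment> \<open>The recurrence \<open>D4\<close> is symmetric, so the growth argument also runs
    downwards; \<open>cst.induct\<close> only supplies two-step induction.\<close>
  have bwd: "k \<le> i \<longrightarrow> D (i - k) \<ge> 0 \<and> D (i - k) \<ge> D (Suc (Suc (i - k))) \<and>
      (k > 0 \<longrightarrow> (\<forall>k. c k > 0) \<longrightarrow> D (i - k) > 0)" for k
  proof (induction k rule: cst.induct)
    case 1
    then show ?case using D0 D2 by simp
  next
    case 2
    show ?case
    proof
      assume "Suc 0 \<le> i"
      then obtain l where i: "i = Suc l" by (cases i) auto
      have "D l = 2 * c l"
        using ab i unfolding i D_def by (simp add: rec algebra_simps)
      then show "D (i - Suc 0) \<ge> 0 \<and> D (i - Suc 0) \<ge> D (Suc (Suc (i - Suc 0))) \<and>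
        (Suc 0 > 0 \<longrightarrow> (\<forall>k. c k > 0) \<longrightarrow> D (i - Suc 0) > 0)"
        using D1 i nonneg[of l] by auto
    qed
  next
    case (3 k)
    show ?case
    proof
      assume le: "Suc (Suc k) \<le> i"
      define l where "l = i - Suc (Suc k)"
      have l: "i - k = Suc (Suc l)" using le by (simp add: l_def)
      have IH: "D (Suc (Suc l)) \<ge> 0" "D (Suc (Suc l)) \<ge> D (Suc (Suc (Suc (Suc l))))"
        using 3(1) le l by auto
      show "0 \<le> D (i - Suc (Suc k)) \<and> D (Suc (Suc (i - Suc (Suc k)))) \<le> D (i - Suc (Suc k)) \<and>
        (0 < Suc (Suc k) \<longrightarrow> (\<forall>k. 0 < c k) \<longrightarrow> 0 < D (i - Suc (Suc k)))"
        using D4[of l] IH nonneg[of "Suc i"] unfolding l_def[symmetric]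
        by (smt (verit))
    qed
  qed
  have nn: "D j \<ge> 0" for j
  proof (cases "j \<le> i")
    case True
    then show ?thesis using bwd[of "i - j"] by simp
  next
    case False
    then show ?thesis using fwd[of "j - i"] by simp
  qed
  show thesis
  proof
    show "\<And>j. c j \<ge> 2 * c (Suc i) + a * fneg j + b * fneg (Suc j)"
      using nn by (simp add: D_def)
    show "\<And>j. j \<in> {i, Suc i, Suc (Suc i)} \<Longrightarrow> c j = 2 * c (Suc i) + a * fneg j + b * fneg (Suc j)"
      using D0 D1 D2 unfolding D_def by auto
    fix j assume pos: "\<And>k. c k > 0" and j: "j \<notin> {i, Suc i, Suc (Suc i)}"
    have "D j > 0"
    proof (cases "j < i")
      case True
      then show ?thesis using bwd[of "i - j"] pos by simp
    next
      case False
      then have "j = i + Suc (Suc (Suc (j - i - 3)))" using j by (simp; linarith)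
      then show ?thesis using fwd_pos[OF pos, of "j - i - 3"] by metis
    qed
    then show "c j > 2 * c (Suc i) + a * fneg j + b * fneg (Suc j)" by (simp add: D_def)
  qed
qed

lemma msum_affine:
  "msum (\<lambda>j. l + a * f j + b * g j) M = l * int (size M) + a * msum f M + b * msum g M"
  by (induction M) (auto simp: algebra_simps)

lemma msum_mono: "(\<And>j. j \<in># M \<Longrightarrow> f j \<le> g j) \<Longrightarrow> msum f M \<le> msum g M"
  by (induction M) (auto intro: add_mono)

lemma msum_strict_mono:
  assumes "\<And>j. j \<in># M \<Longrightarrow> f j \<le> g j" "k \<in># M" "f k < g k"
  shows "msum f M < msum g M"
proof -
  obtain N where M: "M = add_mset k N" using assms(2) by (meson multi_member_split)
  have "msum f N \<le> msum g N" using assms(1) M by (intro msum_mono) auto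
  then show ?thesis using assms(3) by (simp add: M)
qed

text \<open>Weak duality: sum the affine minorant over \<open>M\<close> and over \<open>N\<close>,
  where it is exact. Size and value enter linearly, so each additional element is charged
  \<open>2 * c (Suc i)\<close>. An index outside the window makes the bound strict.\<close>

lemma cost_lower_bound:
  fixes c :: "nat \<Rightarrow> int"
  assumes rec: "\<And>j. c (Suc (Suc j)) = c j + c (Suc j)" and nonneg: "\<And>j. c j \<ge> 0"
    and N: "set_mset N \<subseteq> {i, Suc i, Suc (Suc i)}" and v: "val M = val N"
  shows "msum c N + 2 * c (Suc i) * (int (size M) - int (size N)) \<le> msum c M"
    and "(\<And>k. c k > 0) \<Longrightarrow> \<not> set_mset M \<subseteq> {i, Suc i, Suc (Suc i)} \<Longrightarrow>
      msum c N + 2 * c (Suc i) * (int (size M) - int (size N)) < msum c M"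
proof -
  obtain a b where ab:
    "\<And>j. c j \<ge> 2 * c (Suc i) + a * fneg j + b * fneg (Suc j)"
    "\<And>j. j \<in> {i, Suc i, Suc (Suc i)} \<Longrightarrow> c j = 2 * c (Suc i) + a * fneg j + b * fneg (Suc j)"
    "\<And>j. (\<And>k. c k > 0) \<Longrightarrow> j \<notin> {i, Suc i, Suc (Suc i)} \<Longrightarrow>
       c j > 2 * c (Suc i) + a * fneg j + b * fneg (Suc j)"
    using lp_certificate[of c i, OF rec nonneg] by blast
  let ?L = "\<lambda>j. 2 * c (Suc i) + a * fneg j + b * fneg (Suc j)"
  have cN: "msum c N = msum ?L N"
    by (intro arg_cong[of _ _ sum_mset] image_mset_cong) (use ab(2) N in blast)
  have eq: "msum c N + 2 * c (Suc i) * (int (size M) - int (size N)) = msum ?L M"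
    using v unfolding cN msum_affine val_def by (simp add: algebra_simps)
  show "msum c N + 2 * c (Suc i) * (int (size M) - int (size N)) \<le> msum c M"
    unfolding eq by (intro msum_mono ab(1))
  assume pos: "\<And>k. c k > 0" and "\<not> set_mset M \<subseteq> {i, Suc i, Suc (Suc i)}"
  then obtain k where k: "k \<in># M" "k \<notin> {i, Suc i, Suc (Suc i)}" by blast
  show "msum c N + 2 * c (Suc i) * (int (size M) - int (size N)) < msum c M"
    unfolding eq using msum_strict_mono[of M ?L c k, OF ab(1) k(1) ab(3)[OF pos k(2)]] .
qed

section \<open>Exchanges across gaps and windowed representatives\<close>

text \<open>Costs and values both satisfy this recurrence, so one identity shows that the even-gap
  exchange preserves both.\<close>

lemma even_gap_sum:
  fixes x :: "nat \<Rightarrow> int"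
  assumes "\<And>j. x (Suc (Suc (Suc (Suc j)))) = 3 * x (Suc (Suc j)) - x j"
  shows "x i + x (i + 2 * Suc m) = x (i + 2) + x (i + 2 * m) + (\<Sum>k\<leftarrow>[0..<m]. x (i + 2 * Suc k))"
proof (induction m)
  case (Suc m)
  then show ?case using assms[of "i + 2 * m"] by (simp add: algebra_simps)
qed simp

lemma odd_gap_sum:
  fixes x :: "nat \<Rightarrow> int"
  assumes "\<And>j. x j = x (Suc j) + x (Suc (Suc j))"
  shows "x i = x (i + 2 * r) + (\<Sum>k\<leftarrow>[0..<r]. x (i + 2 * k + 1))"
proof (induction r)
  case (Suc m)
  then show ?case using assms[of "i + 2 * m"] by (simp add: algebra_simps)
qed simp

lemma odd_gap_cost:
  fixes x :: "nat \<Rightarrow> int"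
  assumes "\<And>j. x (Suc (Suc j)) = x j + x (Suc j)"
  shows "(\<Sum>k\<leftarrow>[0..<r]. x (i + 2 * k + 1)) = x (i + 2 * r) - x i"
proof (induction r)
  case (Suc m)
  then show ?case using assms[of "i + 2 * m"] by (simp add: algebra_simps)
qed simp

text \<open>An even gap is closed at equal cost; for an odd gap each cost \<open>x\<close> drops by
  \<open>2 * x i\<close>. The size grows unless \<open>n = 3\<close>, where instead the sum of the
  indices drops by one.\<close>

lemma gap_split:
  assumes "n \<ge> 3"
  obtains K where "val K = val {#i, i + n#}"
    "\<And>d1 d2 R. fits d1 d2 ({#i, i + n#} + R) \<Longrightarrow> fits d1 d2 (K + R)"
    "size K \<ge> 3 \<or> (n = 3 \<and> K = {#Suc i, Suc i#})"
proof (cases "even n")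
  case True
  then obtain m' where "n = 2 * m'" by (elim evenE)
  then obtain m where m: "n = 2 * Suc m" and "m \<ge> 1" using assms by (cases m') auto
  define K where "K = {#i + 2, i + 2 * m#} + mset (map (\<lambda>k. i + 2 * Suc k) [0..<m])"
  have K: "msum x K = msum x {#i, i + n#}"
    if "\<And>j. x (Suc (Suc (Suc (Suc j)))) = 3 * x (Suc (Suc j)) - x j" for x
    using even_gap_sum[of x i m, OF that] unfolding K_def m
    by (simp add: sum_mset_sum_list[symmetric] multiset.map_comp o_def del: map_map)
  show ?thesis
  proof
    show "val K = val {#i, i + n#}"
      using K[of fneg] K[of "\<lambda>j. fneg (Suc j)"] by (simp add: val_def)
    have "msum (\<lambda>j. int (cst j)) K = msum (\<lambda>j. int (cst j)) {#i, i + n#}"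
      "msum (\<lambda>j. int (cst (Suc j))) K = msum (\<lambda>j. int (cst (Suc j))) {#i, i + n#}"
      by (rule K; simp)+
    then show "fits d1 d2 (K + R)" if "fits d1 d2 ({#i, i + n#} + R)" for d1 d2 R
      using that unfolding fits_def by simp
    show "size K \<ge> 3 \<or> (n = 3 \<and> K = {#Suc i, Suc i#})"
      using \<open>m \<ge> 1\<close> by (simp add: K_def)
  qed
next
  case False
  then obtain r where n: "n = 2 * r + 1" by (elim oddE)
  with assms obtain q where r: "r = Suc q" by (cases r) auto
  define K where "K = {#i + 2 * q + 1#} + mset (map (\<lambda>k. i + 2 * k + 1) [0..<r])"
  have msK: "msum x K = x (i + 2 * q + 1) + (\<Sum>k\<leftarrow>[0..<r]. x (i + 2 * k + 1))" for x
    unfolding K_def by (simp add: sum_mset_sum_list[symmetric] multiset.map_comp o_def del: map_map)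
  have K: "msum x K = msum x {#i, i + n#}"
    if "\<And>j. x j = x (Suc j) + x (Suc (Suc j))" for x
    using odd_gap_sum[of x i r, OF that] that[of "i + 2 * q + 1"] unfolding msK
    by (simp add: n r)
  have Kc: "msum x K \<le> msum x {#i, i + n#}"
    if "\<And>j. x (Suc (Suc j)) = x j + x (Suc j)" "\<And>j. x j \<ge> 0" for x
    using odd_gap_cost[of x i r, OF that(1)] that(1)[of "i + 2 * q + 1"] that(2)[of i] unfolding msK
    by (simp add: n r)
  show ?thesis
  proof
    show "val K = val {#i, i + n#}"
      using K[of fneg] K[of "\<lambda>j. fneg (Suc j)"] by (simp add: val_def)
    have "msum (\<lambda>j. int (cst j)) K \<le> msum (\<lambda>j. int (cst j)) {#i, i + n#}"
      "msum (\<lambda>j. int (cst (Suc j))) K \<le> msum (\<lambda>j. int (cst (Suc j))) {#i, i + n#}"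
      by (rule Kc; simp)+
    then show "fits d1 d2 (K + R)" if "fits d1 d2 ({#i, i + n#} + R)" for d1 d2 R
      using that unfolding fits_def by simp
    show "size K \<ge> 3 \<or> (n = 3 \<and> K = {#Suc i, Suc i#})"
      using r by (cases q) (auto simp: K_def n)
  qed
qed

lemma val_union: "val (M + N) = (fst (val M) + fst (val N), snd (val M) + snd (val N))"
  by (simp add: val_def)

text \<open>Among the affordable representations of maximal size take one with least index sum. A
  gap of at least 3 could be split, contradicting maximality of the size or minimality of the
  sum.\<close>

lemma maximal_windowed:
  assumes M: "size M = s" "val M = p" "fits d1 d2 M" and s: "s \<ge> 1"
    and mx: "\<And>N. val N = p \<Longrightarrow> fits d1 d2 N \<Longrightarrow> size N \<le> s"
  obtains N i where "size N = s" "val N = p" "fits d1 d2 N"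
    "i \<in># N" "set_mset N \<subseteq> {i, Suc i, Suc (Suc i)}"
proof -
  let ?P = "\<lambda>N. size N = s \<and> val N = p \<and> fits d1 d2 N"
  have "\<exists>N. ?P N \<and> (\<forall>K. ?P K \<longrightarrow> \<Sum>\<^sub># N \<le> \<Sum>\<^sub># K)"
    using ex_has_least_nat[of ?P M sum_mset] M by blast
  then obtain N where N: "size N = s" "val N = p" "fits d1 d2 N"
    and least: "\<And>K. size K = s \<Longrightarrow> val K = p \<Longrightarrow> fits d1 d2 K \<Longrightarrow> \<Sum>\<^sub># N \<le> \<Sum>\<^sub># K"
    by blast
  define i where "i = Min_mset N"
  have "N \<noteq> {#}" using N(1) s by auto
  then have i: "i \<in># N" "\<And>j. j \<in># N \<Longrightarrow> i \<le> j" by (auto simp: i_def)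
  have "j \<le> i + 2" if j: "j \<in># N" for j
  proof (rule ccontr)
    assume "\<not> j \<le> i + 2"
    then obtain n where n: "n \<ge> 3" "j = i + n"
      using that[of "j - i"] by auto
    obtain R0 where R0: "N = add_mset i R0" using i(1) by (meson multi_member_split)
    have "j \<in># R0" using j n R0 by auto
    then obtain R where R: "R0 = add_mset j R" by (meson multi_member_split)
    have NR: "N = {#i, i + n#} + R" using R0 R n by simp
    obtain K where K: "val K = val {#i, i + n#}"
      "\<And>d1 d2 R. fits d1 d2 ({#i, i + n#} + R) \<Longrightarrow> fits d1 d2 (K + R)"
      "size K \<ge> 3 \<or> (n = 3 \<and> K = {#Suc i, Suc i#})"
      using gap_split[OF n(1), of i] by blast
    have v: "val (K + R) = p" using K(1) N(2) unfolding NR val_union by simp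
    have f: "fits d1 d2 (K + R)" using K(2) N(3) unfolding NR by blast
    have "size K \<le> 2" using mx[OF v f] N(1) unfolding NR by simp
    then have K': "n = 3" "K = {#Suc i, Suc i#}" using K(3) by auto
    have "size (K + R) = s" using N(1) unfolding NR K' by simp
    from least[OF this v f] show False unfolding NR K' by simp
  qed
  then have "set_mset N \<subseteq> {i..i + 2}" using i(2) by auto
  also have "{i..i + 2} = {i, Suc i, Suc (Suc i)}" by auto
  finally have "set_mset N \<subseteq> {i, Suc i, Suc (Suc i)}" .
  with N i(1) that show thesis by blast
qed

section \<open>Windowed configurations and maximal points\<close>

text \<open>The sum of the two costs, which is positive at every index while \<open>cst 1 = 0\<close>.\<close>

definition tot :: "nat \<Rightarrow> nat" where
  "tot j = cst (Suc (Suc j))"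

lemma tot_rec: "tot (Suc (Suc j)) = tot j + tot (Suc j)"
  by (simp add: tot_def)

lemma tot_pos: "tot j > 0"
  unfolding tot_def using cst_Suc_Suc_pos[of j] by linarith

text \<open>A configuration \<open>(i, A, B, C)\<close> stands for \<open>A\<close>, \<open>B\<close> and \<open>C\<close> copies of \<open>i\<close>, \<open>i + 1\<close> and \<open>i + 2\<close>.\<close>

type_synonym cfg = "nat \<times> nat \<times> nat \<times> nat"

fun wms :: "cfg \<Rightarrow> nat multiset" where
  "wms (i, A, B, C) = replicate_mset A i + replicate_mset B (Suc i) + replicate_mset C (Suc (Suc i))"

text \<open>\<open>A \<ge> 1\<close> fixes \<open>i\<close> as the least index, so a windowed
  multiset determines its configuration.\<close>

definition cfgs :: "nat \<Rightarrow> cfg set" where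
  "cfgs s = {(i, A, B, C). A \<ge> 1 \<and> A + B + C = s}"

fun ccost :: "(nat \<Rightarrow> nat) \<Rightarrow> cfg \<Rightarrow> nat" where
  "ccost c (i, A, B, C) = A * c i + B * c (Suc i) + C * c (Suc (Suc i))"

definition fit :: "nat \<Rightarrow> nat \<Rightarrow> cfg \<Rightarrow> bool" where
  "fit d1 d2 x \<longleftrightarrow> ccost cst x \<le> d1 \<and> ccost (\<lambda>j. cst (Suc j)) x \<le> d2"

text \<open>Affordability after exchanging one \<open>i\<close> for \<open>i + 1\<close> and
  \<open>i + 2\<close>, which keeps the value and adds one to the size. The exchanged tuple may have
  first multiplicity 0 and so leave \<open>cfgs\<close>.\<close>

fun fit_succ :: "nat \<Rightarrow> nat \<Rightarrow> cfg \<Rightarrow> bool" where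
  "fit_succ d1 d2 (i, A, B, C) \<longleftrightarrow> fit d1 d2 (i, A - 1, B + 1, C + 1)"

lemma msum_wms: "msum (\<lambda>j. int (c j)) (wms x) = int (ccost c x)"
  by (cases x) simp

lemma fits_wms: "fits d1 d2 (wms x) = fit d1 d2 x"
  unfolding fits_def fit_def msum_wms by simp

lemma size_wms: "x \<in> cfgs s \<Longrightarrow> size (wms x) = s"
  by (auto simp: cfgs_def)

lemma set_wms: "set_mset (wms (i, A, B, C)) \<subseteq> {i, Suc i, Suc (Suc i)}"
  by auto

lemma fit_succ_iff:
  assumes "(i, A, B, C) \<in> cfgs s"
  shows "fit_succ d1 d2 (i, A, B, C) \<longleftrightarrow>
    ccost cst (i, A, B, C) + 2 * cst (Suc i) \<le> d1 \<and>
    ccost (\<lambda>j. cst (Suc j)) (i, A, B, C) + 2 * cst (Suc (Suc i)) \<le> d2"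
proof -
  obtain A' where A: "A = Suc A'" using assms by (cases A) (auto simp: cfgs_def)
  have "ccost c (i, A', B + 1, C + 1) = ccost c (i, A, B, C) + 2 * c (Suc i)"
    if "\<And>j. c (Suc (Suc j)) = c j + c (Suc j)" for c
    using that[of i] by (simp add: A algebra_simps)
  from this[of cst] this[of "\<lambda>j. cst (Suc j)"] show ?thesis
    by (simp add: A fit_def del: ccost.simps)
qed

lemma wms_of_windowed:
  assumes "set_mset N \<subseteq> {i, Suc i, Suc (Suc i)}"
  shows "wms (i, count N i, count N (Suc i), count N (Suc (Suc i))) = N"
proof (rule multiset_eqI)
  fix x
  show "count (wms (i, count N i, count N (Suc i), count N (Suc (Suc i)))) x = count N x"
  proof (cases "x \<in># N")
    case True
    then show ?thesis using assms by auto
  next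
    case False
    then have "count N x = 0" by (simp add: not_in_iff)
    then show ?thesis by (auto simp: count_eq_zero_iff)
  qed
qed

text \<open>An affordable exchange would give a larger representation. Conversely, by duality every
  larger representation costs at least as much as the exchanged one, so it can be affordable only if
  the exchange is.\<close>

lemma maximal_eq_image:
  assumes "s \<ge> 1"
  shows "{p. admits d1 d2 s p \<and> (\<forall>t. admits d1 d2 t p \<longrightarrow> t \<le> s)} =
    (\<lambda>x. val (wms x)) ` {x \<in> cfgs s. fit d1 d2 x \<and> \<not> fit_succ d1 d2 x}" (is "?L = ?R")
proof
  show "?L \<subseteq> ?R"
  proof
    fix p assume "p \<in> ?L"
    then obtain M where M: "size M = s" "val M = p" "fits d1 d2 M"
      and mx: "\<And>N. val N = p \<Longrightarrow> fits d1 d2 N \<Longrightarrow> size N \<le> s"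
      by (auto simp: admits_iff)
    obtain N i where N: "size N = s" "val N = p" "fits d1 d2 N"
      "i \<in># N" "set_mset N \<subseteq> {i, Suc i, Suc (Suc i)}"
      using maximal_windowed[OF M assms mx] by blast
    define A B C where "A = count N i" and "B = count N (Suc i)" and "C = count N (Suc (Suc i))"
    have w: "wms (i, A, B, C) = N" unfolding A_def B_def C_def by (rule wms_of_windowed[OF N(5)])
    have A: "A \<ge> 1" using N(4) by (simp add: A_def)
    have sz: "A + B + C = s" using N(1) unfolding w[symmetric] by simp
    have "\<not> fit_succ d1 d2 (i, A, B, C)"
    proof
      assume "fit_succ d1 d2 (i, A, B, C)"
      then have f: "fits d1 d2 (wms (i, A - 1, B + 1, C + 1))" by (simp only: fits_wms fit_succ.simps)
      obtain A' where A': "A = Suc A'" using A by (cases A) auto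
      have "val (wms (i, A - 1, B + 1, C + 1)) = p"
        unfolding N(2)[symmetric] w[symmetric] by (simp add: A' val_def algebra_simps)
      from mx[OF this f] sz A' show False by simp
    qed
    then show "p \<in> ?R"
      using A sz N(2,3) w fits_wms[of d1 d2 "(i, A, B, C)"]
      by (intro image_eqI[of _ _ "(i, A, B, C)"]) (auto simp: cfgs_def simp del: wms.simps fit_succ.simps)
  qed
next
  show "?R \<subseteq> ?L"
  proof
    fix p assume "p \<in> ?R"
    then obtain i A B C where x: "(i, A, B, C) \<in> cfgs s" and f: "fit d1 d2 (i, A, B, C)"
      and nf: "\<not> fit_succ d1 d2 (i, A, B, C)" and p: "p = val (wms (i, A, B, C))" by auto
    have "admits d1 d2 s p"
      unfolding admits_iff using size_wms[OF x] f p fits_wms by blast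
    moreover have "t \<le> s" if t: "admits d1 d2 t p" for t
    proof (rule ccontr)
      assume "\<not> t \<le> s"
      then have ts: "1 \<le> int t - int s" by simp
      obtain M where M: "size M = t" "val M = p" "fits d1 d2 M" using t by (auto simp: admits_iff)
      have lb: "int (ccost c (i, A, B, C)) + 2 * int (c (Suc i)) \<le> msum (\<lambda>j. int (c j)) M"
        if "\<And>j. c (Suc (Suc j)) = c j + c (Suc j)" for c
      proof -
        have "int (ccost c (i, A, B, C)) + 2 * int (c (Suc i)) * (int t - int s) \<le> msum (\<lambda>j. int (c j)) M"
          using cost_lower_bound(1)[of "\<lambda>j. int (c j)" "wms (i, A, B, C)" i M] set_wms that
          unfolding msum_wms size_wms[OF x] M(1,2) p by simp
        moreover have "2 * int (c (Suc i)) * 1 \<le> 2 * int (c (Suc i)) * (int t - int s)"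
          using ts by (intro mult_left_mono) auto
        ultimately show ?thesis by simp
      qed
      have "fit_succ d1 d2 (i, A, B, C)"
        unfolding fit_succ_iff[OF x]
        using lb[of cst] lb[of "\<lambda>j. cst (Suc j)"] M(3) unfolding fits_def by (simp del: ccost.simps)
      with nf show False by simp
    qed
    ultimately show "p \<in> ?L" by simp
  qed
qed

lemma window_start_le:
  assumes x: "(i, A, B, C) \<in> cfgs s" and y: "(i', A', B', C') \<in> cfgs s"
    and v: "val (wms (i, A, B, C)) = val (wms (i', A', B', C'))"
    and le: "ccost tot (i', A', B', C') \<le> ccost tot (i, A, B, C)"
  shows "i \<le> i' \<and> i' \<le> Suc (Suc i)"
proof -
  have "set_mset (wms (i', A', B', C')) \<subseteq> {i, Suc i, Suc (Suc i)}"
  proof (rule ccontr)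
    assume "\<not> ?thesis"
    then have "int (ccost tot (i, A, B, C)) <
        int (ccost tot (i', A', B', C'))"
      using cost_lower_bound(2)[of "\<lambda>j. int (tot j)" "wms (i, A, B, C)" i
          "wms (i', A', B', C')", OF _ _ set_wms v[symmetric]] tot_pos
      unfolding msum_wms size_wms[OF x] size_wms[OF y]
      by (simp add: tot_rec del: wms.simps ccost.simps)
    with le show False by linarith
  qed
  then have "i' \<in> {i, Suc i, Suc (Suc i)}" using y by (auto simp: cfgs_def)
  then show ?thesis by auto
qed

text \<open>Duality in both directions gives equal total costs; strictness then puts each support
  into the window of the other, so the windows coincide.\<close>

lemma val_wms_inj: "inj_on (\<lambda>x. val (wms x)) (cfgs s)"
proof (rule inj_onI)
  fix x y assume xy: "x \<in> cfgs s" "y \<in> cfgs s" and v: "val (wms x) = val (wms y)"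
  obtain i A B C where x: "x = (i, A, B, C)" by (cases x)
  obtain i' A' B' C' where y: "y = (i', A', B', C')" by (cases y)
  have "int (ccost tot x) \<le> int (ccost tot y)" "int (ccost tot y) \<le> int (ccost tot x)"
    using cost_lower_bound(1)[of "\<lambda>j. int (tot j)" "wms x" i "wms y"]
      cost_lower_bound(1)[of "\<lambda>j. int (tot j)" "wms y" i' "wms x"]
      set_wms[of i A B C] set_wms[of i' A' B' C'] v
    unfolding msum_wms x y
    by (simp_all add: tot_rec size_wms[OF xy(1)[unfolded x]] size_wms[OF xy(2)[unfolded y]] del: wms.simps ccost.simps)
  then have eq: "ccost tot x = ccost tot y" by simp
  have i: "i' = i"
    using window_start_le[of i A B C s i' A' B' C'] window_start_le[of i' A' B' C' s i A B C]
      xy v eq unfolding x y by (metis le_antisym order_refl)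
  \<comment> \<open>\<open>P\<close> and \<open>Q\<close> are the coordinates of the difference of
    the values in the basis given by \<open>i\<close> and \<open>Suc i\<close>, with
    \<open>i + 2\<close> expanded as \<open>i\<close> minus \<open>i + 1\<close>.\<close>
  define P where "P = int A - int A' + int C - int C'"
  define Q where "Q = int B - int B' - int C + int C'"
  have "P * fneg i + Q * fneg (Suc i) = 0" "P * fneg (Suc i) + Q * fneg (Suc (Suc i)) = 0"
    using v unfolding x y i by (simp_all add: val_def P_def Q_def algebra_simps)
  have PQ0: "P = 0 \<and> Q = 0"
    if "P * fneg k + Q * fneg (Suc k) = 0" "P * fneg (Suc k) + Q * fneg (Suc (Suc k)) = 0" for k
    using that by (induction k) (simp_all add: algebra_simps)
  then have "P = 0 \<and> Q = 0" using \<open>P * fneg i + Q * fneg (Suc i) = 0\<close>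
      \<open>P * fneg (Suc i) + Q * fneg (Suc (Suc i)) = 0\<close> by blast
  then have "A = A' \<and> B = B' \<and> C = C'"
    using xy unfolding x y P_def Q_def cfgs_def by auto
  then show "x = y" by (simp add: x y i)
qed

section \<open>The map \<open>nxt\<close> and its orbits\<close>

text \<open>An index \<open>i\<close> is replaced by \<open>i + 2\<close>; the other cases renormalise the window after its first
  entry has been used up.\<close>

fun nxt :: "cfg \<Rightarrow> cfg" where
  "nxt (i, A, B, C) =
    (if A \<ge> 2 then (i, A - 1, B, Suc C)
     else if B \<ge> 1 then (Suc i, B, Suc C, 0)
     else (Suc (Suc i), Suc C, 0, 0))"

fun odds :: "cfg \<Rightarrow> nat" where
  "odds (i, A, B, C) = (if even i then B else A + C)"

lemma nxt_cfgs: "x \<in> cfgs s \<Longrightarrow> nxt x \<in> cfgs s"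
  by (cases x) (auto simp: cfgs_def)

lemma odds_nxt: "x \<in> cfgs s \<Longrightarrow> odds (nxt x) = odds x"
  by (cases x) (auto simp: cfgs_def)

lemma nxt_inj: "inj_on nxt (cfgs s)"
  by (rule inj_onI) (auto simp: cfgs_def split: if_splits)

lemma ccost_nxt:
  assumes "(i, A, B, C) \<in> cfgs s" and rec: "\<And>j. c (Suc (Suc j)) = c j + c (Suc j)"
  shows "ccost c (nxt (i, A, B, C)) = ccost c (i, A, B, C) + c (Suc i)"
proof -
  obtain A' where A: "A = Suc A'" using assms by (cases A) (auto simp: cfgs_def)
  show ?thesis
    using rec[of i] rec[of "Suc i"] rec[of "Suc (Suc i)"] by (cases A'; cases B) (auto simp: A algebra_simps)
qed

lemma fit_nxt_iff:
  assumes "(i, A, B, C) \<in> cfgs s"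
  shows "fit d1 d2 (nxt (i, A, B, C)) \<longleftrightarrow>
    ccost cst (i, A, B, C) + cst (Suc i) \<le> d1 \<and>
    ccost (\<lambda>j. cst (Suc j)) (i, A, B, C) + cst (Suc (Suc i)) \<le> d2"
  unfolding fit_def by (subst (1 2) ccost_nxt[OF assms]) auto

lemma fit_nxtD: "x \<in> cfgs s \<Longrightarrow> fit d1 d2 (nxt x) \<Longrightarrow> fit d1 d2 x"
  by (cases x) (simp only: fit_nxt_iff, simp only: fit_def, linarith)

lemma fit_succ_imp_fit_nxt: "x \<in> cfgs s \<Longrightarrow> fit_succ d1 d2 x \<Longrightarrow> fit d1 d2 (nxt x)"
  by (cases x) (simp only: fit_nxt_iff fit_succ_iff, linarith)

text \<open>The starting point of the orbit with \<open>k\<close> odd indices: \<open>s - k\<close>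
  zeros and \<open>k\<close> ones. For \<open>k = s\<close> no zero is left and the window begins at
  1.\<close>

definition start :: "nat \<Rightarrow> nat \<Rightarrow> cfg" where
  "start s k = (if k < s then (0, s - k, k, 0) else (1, s, 0, 0))"

text \<open>A predecessor replaces one largest index \<open>m\<close> by \<open>m - 2\<close>, which
  is impossible only when all indices are 0 or 1.\<close>

lemma start_or_nxt:
  assumes "x \<in> cfgs s"
  obtains "x = start s (odds x)" "odds x \<le> s" | y where "y \<in> cfgs s" "x = nxt y"
proof -
  obtain i A B C where x: "x = (i, A, B, C)" by (cases x)
  consider "C \<ge> 1" | "C = 0" "i = 0" | "C = 0" "B = 0" "i = 1" | j where "C = 0" "B \<ge> 1" "i = Suc j"
    | j where "C = 0" "B = 0" "i = Suc (Suc j)"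
    by (metis One_nat_def not0_implies_Suc not_less_eq_eq zero_le)
  then show thesis
  proof cases
    case 1
    then show ?thesis using assms that(2)[of "(i, Suc A, B, C - 1)"] by (auto simp: x cfgs_def)
  next
    case 2
    then show ?thesis using assms that(1) by (auto simp: x cfgs_def start_def)
  next
    case 3
    then show ?thesis using assms that(1) by (auto simp: x cfgs_def start_def)
  next
    case (4 j)
    then show ?thesis using assms that(2)[of "(j, 1, A, B - 1)"] by (auto simp: x cfgs_def)
  next
    case (5 j)
    then show ?thesis using assms that(2)[of "(j, 1, 0, A - 1)"] by (auto simp: x cfgs_def)
  qed
qed

lemma start_cfgs: "s \<ge> 1 \<Longrightarrow> start s k \<in> cfgs s"
  by (auto simp: start_def cfgs_def)

lemma odds_start: "k \<le> s \<Longrightarrow> odds (start s k) = k"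
  by (auto simp: start_def)

lemma fit_start: "k \<le> s \<Longrightarrow> fit d1 d2 (start s k) \<longleftrightarrow> s - k \<le> d1 \<and> k \<le> d2"
  by (auto simp: start_def fit_def)

lemma row_cfgs: "s \<ge> 1 \<Longrightarrow> (nxt ^^ t) (start s k) \<in> cfgs s"
  by (induction t) (auto simp: start_cfgs nxt_cfgs)

lemma odds_row: "s \<ge> 1 \<Longrightarrow> k \<le> s \<Longrightarrow> odds ((nxt ^^ t) (start s k)) = k"
  by (induction t) (auto simp: odds_start odds_nxt[OF row_cfgs])

text \<open>Going back along \<open>nxt\<close> terminates because it strictly lowers the total
  cost, and \<open>odds\<close> is constant on the way.\<close>

lemma row_exhaust:
  assumes "x \<in> cfgs s"
  shows "odds x \<le> s \<and> (\<exists>t. x = (nxt ^^ t) (start s (odds x)))"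
  using assms
proof (induction "ccost tot x" arbitrary: x rule: less_induct)
  case less
  from less.prems show ?case
  proof (cases rule: start_or_nxt)
    case 1
    then show ?thesis by (metis funpow_0)
  next
    case (2 y)
    obtain i A B C where y: "y = (i, A, B, C)" by (cases y)
    have "ccost tot y < ccost tot x"
      using ccost_nxt[of i A B C s tot] 2 tot_pos[of "Suc i"] unfolding y 2(2)
      by (simp add: tot_rec del: nxt.simps ccost.simps)
    from less.hyps[OF this 2(1)] obtain t where t: "odds y \<le> s" "y = (nxt ^^ t) (start s (odds y))" by blast
    have "odds x = odds y" using 2 odds_nxt by simp
    then have "x = (nxt ^^ Suc t) (start s (odds x))" using t 2 by simp
    then show ?thesis using t(1) \<open>odds x = odds y\<close> by metis
  qed
qed

lemma unique_threshold:
  fixes P :: "nat \<Rightarrow> bool"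
  assumes "P 0" "\<And>n. P (Suc n) \<Longrightarrow> P n" "\<not> P m"
  shows "\<exists>!n. P n \<and> \<not> P (Suc n)"
proof -
  have down: "P b \<longrightarrow> P a" if "a \<le> b" for a b
    using that by (induction rule: dec_induct) (use assms(2) in auto)
  have "\<exists>n. P n \<and> \<not> P (Suc n)" using assms(1,3) by (metis nat_induct)
  then show ?thesis using down by (metis Suc_leI nat_neq_iff)
qed

text \<open>The second cost is used because the first can stay constant in a step, as
  \<open>cst 1 = 0\<close>.\<close>

lemma row_cost_ge: "s \<ge> 1 \<Longrightarrow> ccost (\<lambda>j. cst (Suc j)) ((nxt ^^ t) (start s k)) \<ge> t"
proof (induction t)
  case (Suc t)
  obtain i A B C where x: "(nxt ^^ t) (start s k) = (i, A, B, C)" by (cases "(nxt ^^ t) (start s k)")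
  have "(i, A, B, C) \<in> cfgs s" using row_cfgs[OF Suc.prems, of t k] x by simp
  then show ?case
    using ccost_nxt[of i A B C s "\<lambda>j. cst (Suc j)"] Suc cst_Suc_Suc_pos[of i] x
    by (simp del: nxt.simps ccost.simps)
qed simp

definition lasts :: "nat \<Rightarrow> nat \<Rightarrow> nat \<Rightarrow> cfg set" where
  "lasts d1 d2 s = {x \<in> cfgs s. fit d1 d2 x \<and> \<not> fit d1 d2 (nxt x)}"

text \<open>Along an orbit affordability is lost exactly once, so each orbit with affordable start
  contributes one element. The start with \<open>k\<close> odd indices costs \<open>s - k\<close>
  and \<open>k\<close>, which gives the interval.\<close>

lemma lasts_bij:
  assumes s: "s \<ge> 1"
  shows "bij_betw odds (lasts d1 d2 s) {s - d1..min s d2}"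
proof -
  let ?r = "\<lambda>k t. (nxt ^^ t) (start s k)"
  have down: "fit d1 d2 (?r k t)" if "fit d1 d2 (?r k (Suc t))" for k t
    using fit_nxtD[OF row_cfgs[OF s, of t k]] that by simp
  have down0: "fit d1 d2 (start s k)" if "fit d1 d2 (?r k t)" for k t
    using that by (induction t) (use down in auto)
  have uniq: "\<exists>!t. fit d1 d2 (?r k t) \<and> \<not> fit d1 d2 (?r k (Suc t))"
    if "fit d1 d2 (start s k)" for k
  proof (rule unique_threshold)
    show "\<not> fit d1 d2 (?r k (Suc d2))"
      using row_cost_ge[OF s, of "Suc d2" k] unfolding fit_def by linarith
  qed (use that down in auto)
  have "inj_on odds (lasts d1 d2 s)"
  proof (rule inj_onI)
    fix x y assume x: "x \<in> lasts d1 d2 s" and y: "y \<in> lasts d1 d2 s" and o: "odds x = odds y"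
    obtain t where t: "x = ?r (odds x) t" using row_exhaust[of x s] x unfolding lasts_def by blast
    obtain u where u: "y = ?r (odds x) u" using row_exhaust[of y s] y unfolding lasts_def o by blast
    have "fit d1 d2 (start s (odds x))" using down0[of t "odds x"] t x by (simp add: lasts_def)
    moreover have "fit d1 d2 (?r (odds x) t) \<and> \<not> fit d1 d2 (?r (odds x) (Suc t))"
      using x t by (auto simp: lasts_def)
    moreover have "fit d1 d2 (?r (odds x) u) \<and> \<not> fit d1 d2 (?r (odds x) (Suc u))"
      using y u by (auto simp: lasts_def)
    ultimately have "t = u" using uniq by blast
    then show "x = y" using t u by simp
  qed
  moreover have "odds ` lasts d1 d2 s = {s - d1..min s d2}"
  proof (intro equalityI subsetI)
    fix k assume "k \<in> odds ` lasts d1 d2 s"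
    then obtain x where x: "x \<in> lasts d1 d2 s" "k = odds x" by blast
    obtain t where t: "x = ?r k t" "k \<le> s" using row_exhaust[of x s] x unfolding lasts_def by blast
    have "fit d1 d2 x" using x(1) by (simp add: lasts_def)
    then have "fit d1 d2 (start s k)" using down0[of t k] unfolding t(1)[symmetric] by blast
    then show "k \<in> {s - d1..min s d2}" using fit_start t(2) by auto
  next
    fix k assume k: "k \<in> {s - d1..min s d2}"
    then have "fit d1 d2 (start s k)" by (subst fit_start) auto
    then obtain t where "fit d1 d2 (?r k t) \<and> \<not> fit d1 d2 (?r k (Suc t))" using uniq by blast
    then have "?r k t \<in> lasts d1 d2 s" using row_cfgs[OF s] by (auto simp: lasts_def)
    then show "k \<in> odds ` lasts d1 d2 s"
      by (rule rev_image_eqI) (use odds_row[OF s] k in simp)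
  qed
  ultimately show ?thesis by (simp add: bij_betw_def)
qed

lemma card_lasts:
  assumes "s \<ge> 1" "s \<le> d1 + d2"
  shows "card (lasts d1 d2 s) = min (min d1 d2) (min s (d1 + d2 - s)) + 1"
  using bij_betw_same_card[OF lasts_bij[OF assms(1), of d1 d2]] assms(2) by simp linarith

lemma finite_lasts: "s \<ge> 1 \<Longrightarrow> finite (lasts d1 d2 s)"
  using bij_betw_finite[OF lasts_bij] by blast

lemma lasts_empty:
  assumes "s \<ge> 1" "s > d1 + d2"
  shows "lasts d1 d2 s = {}"
  using lasts_bij[OF assms(1), of d1 d2] assms(2) by (simp add: bij_betw_def)

section \<open>The image of \<open>nxt\<close> and the one element it misses\<close>

definition between :: "nat \<Rightarrow> nat \<Rightarrow> nat \<Rightarrow> cfg set" where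
  "between d1 d2 s = {x \<in> cfgs s. fit d1 d2 (nxt x) \<and> \<not> fit_succ d1 d2 x}"

lemma maximal_cfgs_split:
  "{x \<in> cfgs s. fit d1 d2 x \<and> \<not> fit_succ d1 d2 x} = lasts d1 d2 s \<union> between d1 d2 s"
  "lasts d1 d2 s \<inter> between d1 d2 s = {}"
  using fit_nxtD fit_succ_imp_fit_nxt unfolding lasts_def between_def by blast+

lemma cst_mono: "1 \<le> i \<Longrightarrow> cst i \<le> cst (Suc i)"
  by (cases i rule: cst.cases) auto

text \<open>The window never moves left, so by \<open>cst_mono\<close> two steps of
  \<open>nxt\<close> cost at least twice the first one, that is, at least the exchange that is
  unaffordable.\<close>

lemma nxt_between:
  assumes "x \<in> between d1 d2 s"
  shows "nxt x \<in> lasts d1 d2 s"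
proof -
  obtain i A B C where x: "x = (i, A, B, C)" by (cases x)
  obtain i' A' B' C' where y: "nxt x = (i', A', B', C')" by (cases "nxt x")
  have xc: "(i, A, B, C) \<in> cfgs s" and yc: "(i', A', B', C') \<in> cfgs s"
    and f: "fit d1 d2 (nxt x)" and nf: "\<not> fit_succ d1 d2 (i, A, B, C)"
    using assms nxt_cfgs[of x s] y x by (auto simp: between_def)
  have "i' \<in> {i, Suc i, Suc (Suc i)}" using y x by (auto split: if_splits)
  then have mono: "cst (Suc i) \<le> cst (Suc i')" "cst (Suc (Suc i)) \<le> cst (Suc (Suc i'))"
    using cst_mono[of "Suc i"] cst_mono[of "Suc (Suc i)"] cst_mono[of "Suc (Suc (Suc i))"] by auto
  have "ccost cst (i', A', B', C') = ccost cst (i, A, B, C) + cst (Suc i)"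
    "ccost (\<lambda>j. cst (Suc j)) (i', A', B', C') = ccost (\<lambda>j. cst (Suc j)) (i, A, B, C) + cst (Suc (Suc i))"
    unfolding y[symmetric] x by (subst ccost_nxt[OF xc]; simp)+
  then have "\<not> fit d1 d2 (nxt (nxt x))"
    using nf mono unfolding y fit_nxt_iff[OF yc] fit_succ_iff[OF xc] by linarith
  then show ?thesis using f yc y by (simp add: lasts_def)
qed

text \<open>The configurations with \<open>C = 0\<close> form a chain; among them are all configurations without a
  predecessor under \<open>nxt\<close> and all those where \<open>nxt\<close> has moved the window. For the latter, \<open>room\<close>
  says that the predecessor also admits the exchange of \<open>i\<close> for \<open>i + 1\<close> and \<open>i + 2\<close>. Along the
  chain, \<open>room\<close> is a threshold condition, and failing at the next link means having an unaffordable
  image under \<open>nxt\<close> (up to the first coordinate when \<open>j = 0\<close>): this is why a single element is missed.\<close>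

definition link :: "nat \<Rightarrow> nat \<Rightarrow> cfg" where
  "link s n = (n div s, s - n mod s, n mod s, 0)"

fun room :: "nat \<Rightarrow> nat \<Rightarrow> cfg \<Rightarrow> bool" where
  "room d1 d2 (j, A, B, C) =
    (if j = 0 then B \<le> d2
     else if j = 1 \<and> B = 0 then A \<le> d2
     else let e = (if B = 0 then j - 1 else j) in
       ccost cst (j, A, B, C) + cst e \<le> d1 \<and> ccost (\<lambda>j. cst (Suc j)) (j, A, B, C) + cst (Suc e) \<le> d2)"

lemma link_Suc:
  assumes "s \<ge> 1" "link s n = (j, A, B, 0)"
  shows "link s (Suc n) = (if A \<ge> 2 then (j, A - 1, Suc B, 0) else (Suc j, s, 0, 0))"
proof -
  have "n mod s < s" using assms(1) by simp
  then have "2 \<le> s - n mod s \<longleftrightarrow> Suc (n mod s) \<noteq> s" by linarith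
  then show ?thesis using assms by (auto simp: link_def mod_Suc div_Suc)
qed

lemma link_cases:
  assumes "s \<ge> 1"
  obtains j A B where "link s n = (j, Suc A, B, 0)" "s = Suc A + B"
proof -
  have "n mod s < s" using assms by simp
  then show thesis using that[of "n div s" "s - n mod s - 1" "n mod s"] by (simp add: link_def)
qed

text \<open>The next link trades one \<open>j\<close> for \<open>Suc j\<close>, and for
  \<open>j > 0\<close> its \<open>e\<close> is \<open>j\<close>. Adding \<open>c e\<close> therefore
  leaves the old cost plus \<open>c (Suc j)\<close>, the cost after \<open>nxt\<close>.\<close>

lemma room_link_Suc:
  assumes s: "s \<ge> 1" and y: "link s n = (j, A, B, 0)"
  shows "room d1 d2 (link s (Suc n)) \<longleftrightarrow>
    (if j = 0 then Suc B \<le> d2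
     else ccost cst (j, A, B, 0) + cst (Suc j) \<le> d1 \<and>
       ccost (\<lambda>j. cst (Suc j)) (j, A, B, 0) + cst (Suc (Suc j)) \<le> d2)"
proof -
  obtain A' where A: "A = Suc A'" "s = Suc A' + B" using link_cases[OF s, of n] y by (metis prod.inject)
  show ?thesis
    unfolding link_Suc[OF s y] using A by (cases A'; cases j) (auto simp: algebra_simps)
qed

lemma room_link_mono:
  assumes s: "s \<ge> 1" and f: "room d1 d2 (link s (Suc n))"
  shows "room d1 d2 (link s n)"
proof -
  obtain j A B where y: "link s n = (j, Suc A, B, 0)" "s = Suc A + B"
    using link_cases[OF s] by blast
  show ?thesis
  proof (cases j)
    case 0
    then show ?thesis using f unfolding room_link_Suc[OF s y(1)] unfolding y(1) by simp
  next
    case (Suc l)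
    have "cst j \<le> cst (Suc j)" "cst (Suc j) \<le> cst (Suc (Suc j))" "cst (j - 1) \<le> cst (Suc j)"
      "cst (Suc (j - 1)) \<le> cst (Suc (Suc j))"
      using cst_mono[of j] cst_mono[of "Suc j"] Suc by simp_all
    then show ?thesis using f Suc unfolding room_link_Suc[OF s y(1)] unfolding y(1)
      by (auto simp: Let_def)
  qed
qed

lemma room_link_unique:
  assumes s: "s \<ge> 1"
  shows "\<exists>!n. room d1 d2 (link s n) \<and> \<not> room d1 d2 (link s (Suc n))"
proof (rule unique_threshold)
  show "room d1 d2 (link s 0)" using s by (simp add: link_def)
  show "room d1 d2 (link s n)" if "room d1 d2 (link s (Suc n))" for n
    using room_link_mono[OF s that] .
  obtain t where t: "s = Suc t" using s by (cases s) auto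
  \<comment> \<open>This link consists of \<open>s\<close> copies of \<open>d2 + 5\<close>, whose
    second cost already exceeds \<open>d2\<close>.\<close>
  have "link s ((d2 + 5) * s) = (d2 + 5, s, 0, 0)" using s by (simp add: link_def)
  moreover have "cst (Suc (d2 + 5)) \<ge> d2 + 2"
    using cst_ge[of "d2 + 2"] by (simp add: eval_nat_numeral)
  moreover have "cst (Suc (d2 + 5)) \<le> s * cst (Suc (d2 + 5))" by (simp add: t)
  ultimately have "link s ((d2 + 5) * s) = (d2 + 5, s, 0, 0) \<and> d2 < s * cst (Suc (d2 + 5))"
    by linarith
  then show "\<not> room d1 d2 (link s ((d2 + 5) * s))"
    by (simp add: Let_def del: cst.simps)
qed

lemma unreached_iff:
  assumes y: "y \<in> lasts d1 d2 s"
  shows "y \<notin> nxt ` between d1 d2 s \<longleftrightarrow> (\<forall>x\<in>cfgs s. y = nxt x \<longrightarrow> fit_succ d1 d2 x)"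
  using y unfolding between_def lasts_def by auto

text \<open>If the link has a predecessor under \<open>nxt\<close>, with window start
  \<open>k\<close>, then \<open>Suc k\<close> is the \<open>e\<close> of \<open>room\<close>, and
  the exchange there costs one more \<open>c e\<close> than the link. Without a predecessor the link
  is unreached, and \<open>room\<close> follows from affordability.\<close>

lemma unreached_link:
  assumes s: "s \<ge> 1" and y: "link s n \<in> lasts d1 d2 s"
  shows "link s n \<notin> nxt ` between d1 d2 s \<longleftrightarrow> room d1 d2 (link s n)"
proof -
  obtain j A B where l: "link s n = (j, Suc A, B, 0)" "s = Suc A + B"
    using link_cases[OF s] by blast
  have f: "fit d1 d2 (j, Suc A, B, 0)" using y l(1) by (simp add: lasts_def)
  consider "j = 0" | "j = 1" "B = 0" | k where "j = Suc k" "B \<ge> 1" | k where "j = Suc (Suc k)" "B = 0"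
    by (metis One_nat_def not0_implies_Suc not_less_eq_eq zero_le)
  then show ?thesis
  proof cases
    case 1
    then show ?thesis
      using f unfolding unreached_iff[OF y] unfolding l(1) by (auto simp: fit_def split: if_splits)
  next
    case 2
    then show ?thesis
      using f unfolding unreached_iff[OF y] unfolding l(1) by (auto simp: fit_def cfgs_def split: if_splits)
  next
    case (3 k)
    let ?x = "(k, 1, Suc A, B - 1)"
    have x: "?x \<in> cfgs s" using 3 l by (simp add: cfgs_def)
    have nx: "nxt ?x = link s n" using 3 l by simp
    have "link s n = nxt x \<longleftrightarrow> x = ?x" if "x \<in> cfgs s" for x
      using nxt_inj x that nx by (metis inj_onD)
    then have "link s n \<notin> nxt ` between d1 d2 s \<longleftrightarrow> fit_succ d1 d2 ?x"
      unfolding unreached_iff[OF y] using x by blast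
    also have "\<dots> \<longleftrightarrow> room d1 d2 (link s n)"
      unfolding fit_succ_iff[OF x] using 3 unfolding l(1)
      by (cases B) (auto simp: Let_def algebra_simps)
    finally show ?thesis .
  next
    case (4 k)
    let ?x = "(k, 1, 0, A)"
    have x: "?x \<in> cfgs s" using 4 l by (simp add: cfgs_def)
    have nx: "nxt ?x = link s n" using 4 l by simp
    have "link s n = nxt x \<longleftrightarrow> x = ?x" if "x \<in> cfgs s" for x
      using nxt_inj x that nx by (metis inj_onD)
    then have "link s n \<notin> nxt ` between d1 d2 s \<longleftrightarrow> fit_succ d1 d2 ?x"
      unfolding unreached_iff[OF y] using x by blast
    also have "\<dots> \<longleftrightarrow> room d1 d2 (link s n)"
      unfolding fit_succ_iff[OF x] using 4 unfolding l(1)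
      by (auto simp: Let_def algebra_simps)
    finally show ?thesis .
  qed
qed

lemma link_lasts:
  assumes s: "s \<ge> 1" "s \<le> d1 + d2"
    and r: "room d1 d2 (link s n)" "\<not> room d1 d2 (link s (Suc n))"
  shows "link s n \<in> lasts d1 d2 s"
proof -
  obtain j A B where l: "link s n = (j, Suc A, B, 0)" "s = Suc A + B"
    using link_cases[OF s(1)] by blast
  have c: "(j, Suc A, B, 0) \<in> cfgs s" using l by (simp add: cfgs_def)
  \<comment> \<open>For \<open>j = 0\<close> the threshold forces \<open>B = d2\<close>, and
    \<open>s \<le> d1 + d2\<close> then leaves at most \<open>d1\<close> zeros.\<close>
  have "fit d1 d2 (j, Suc A, B, 0)"
    using r(1) r(2)[unfolded room_link_Suc[OF s(1) l(1)]] s l(2) unfolding l(1)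
    by (cases "j = 0"; cases "j = 1 \<and> B = 0") (auto simp: fit_def Let_def)
  moreover have "\<not> fit d1 d2 (nxt (j, Suc A, B, 0))"
    using r(2) unfolding fit_nxt_iff[OF c] room_link_Suc[OF s(1) l(1)] by (auto split: if_splits)
  ultimately show ?thesis using c by (simp add: lasts_def l(1) del: nxt.simps)
qed

lemma lasts_unreached:
  assumes s: "s \<ge> 1" and y: "y \<in> lasts d1 d2 s" "y \<notin> nxt ` between d1 d2 s"
  obtains n where "y = link s n" "room d1 d2 (link s n)" "\<not> room d1 d2 (link s (Suc n))"
proof -
  obtain j A B C where yd: "y = (j, A, B, C)" by (cases y)
  have yc: "(j, A, B, C) \<in> cfgs s" and nf: "\<not> fit d1 d2 (nxt (j, A, B, C))"
    and f: "fit d1 d2 (j, A, B, C)" using y yd by (auto simp: lasts_def)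
  \<comment> \<open>Otherwise the predecessor has the same \<open>i\<close>, so its exchange costs
    exactly as much as two steps of \<open>nxt\<close>, and \<open>nxt y\<close> would be
    affordable.\<close>
  have C: "C = 0"
  proof (rule ccontr)
    assume "C \<noteq> 0"
    then obtain C' where C': "C = Suc C'" by (cases C) auto
    let ?x = "(j, Suc A, B, C')"
    have x: "?x \<in> cfgs s" and nx: "y = nxt ?x" using yc by (auto simp: cfgs_def C' yd)
    then have "fit_succ d1 d2 ?x" using y unfolding unreached_iff[OF y(1)] by blast
    then have "fit d1 d2 (nxt y)"
      unfolding fit_succ_iff[OF x] unfolding yd fit_nxt_iff[OF yc] unfolding C'
      by (simp add: algebra_simps)
    then show False using nf yd by simp
  qed
  define n where "n = j * s + B"
  have "B < s" "s = A + B" using yc C by (auto simp: cfgs_def)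
  then have l: "y = link s n" by (simp add: link_def n_def yd C)
  then have r: "room d1 d2 (link s n)" using unreached_link[OF s] y by blast
  moreover have "\<not> room d1 d2 (link s (Suc n))"
  proof (cases "j = 0")
    \<comment> \<open>Here \<open>nxt\<close> adds \<open>cst 1 = 0\<close> to the first cost, so
      only the second bound can fail.\<close>
    case True
    show ?thesis
      using nf f True unfolding room_link_Suc[OF s l[symmetric, unfolded yd C]] fit_nxt_iff[OF yc]
      by (auto simp: fit_def C)
  next
    case False
    then show ?thesis
      using nf unfolding room_link_Suc[OF s l[symmetric, unfolded yd C]] fit_nxt_iff[OF yc] by (simp add: C)
  qed
  ultimately show thesis using that l by blast
qed

lemma card_between:
  assumes s: "s \<ge> 1" "s \<le> d1 + d2"
  shows "finite (between d1 d2 s)" "card (lasts d1 d2 s) = Suc (card (between d1 d2 s))"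
proof -
  let ?N = "nxt ` between d1 d2 s"
  have inj: "inj_on nxt (between d1 d2 s)"
    by (rule inj_on_subset[OF nxt_inj[of s]]) (auto simp: between_def)
  have sub: "?N \<subseteq> lasts d1 d2 s" using nxt_between by blast
  obtain n where n: "room d1 d2 (link s n)" "\<not> room d1 d2 (link s (Suc n))"
    and uniq: "\<And>m. room d1 d2 (link s m) \<Longrightarrow> \<not> room d1 d2 (link s (Suc m)) \<Longrightarrow> m = n"
    using room_link_unique[OF s(1), of d1 d2] by (metis (no_types, lifting))
  have mem: "link s n \<in> lasts d1 d2 s" using link_lasts[OF s n] .
  have nmem: "link s n \<notin> ?N" using unreached_link[OF s(1) mem] n(1) by blast
  have "lasts d1 d2 s = insert (link s n) ?N"
  proof (intro equalityI subsetI)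
    fix y assume y: "y \<in> lasts d1 d2 s"
    show "y \<in> insert (link s n) ?N"
    proof (rule ccontr)
      assume ny: "y \<notin> insert (link s n) ?N"
      then obtain m where "y = link s m" "room d1 d2 (link s m)" "\<not> room d1 d2 (link s (Suc m))"
        using lasts_unreached[OF s(1) y] by blast
      then show False using uniq[of m] ny by simp
    qed
  qed (use sub mem in blast)
  moreover have fin: "finite ?N" using finite_subset[OF sub finite_lasts[OF s(1)]] .
  ultimately have "card (lasts d1 d2 s) = Suc (card ?N)" using nmem by simp
  then show "card (lasts d1 d2 s) = Suc (card (between d1 d2 s))" using card_image[OF inj] by simp
  show "finite (between d1 d2 s)" using fin finite_image_iff[OF inj] by blast
qed

section \<open>The final count and the case of size zero\<close>

lemma card_maximal_cfgs:
  assumes s: "s \<ge> 1"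
  shows "card {x \<in> cfgs s. fit d1 d2 x \<and> \<not> fit_succ d1 d2 x} =
    (if s \<le> d1 + d2 then 2 * min (min d1 d2) (min s (d1 + d2 - s)) + 1 else 0)"
proof (cases "s \<le> d1 + d2")
  case True
  have "card (lasts d1 d2 s \<union> between d1 d2 s) = card (lasts d1 d2 s) + card (between d1 d2 s)"
    using card_between(1)[OF s True] finite_lasts[OF s] maximal_cfgs_split(2)
    by (intro card_Un_disjoint) auto
  then show ?thesis
    unfolding maximal_cfgs_split(1) using card_between(2)[OF s True] card_lasts[OF s True] True by simp
next
  case False
  then have "lasts d1 d2 s = {}" using lasts_empty[OF s] by simp
  moreover have "between d1 d2 s = {}" using nxt_between calculation by blast
  ultimately show ?thesis unfolding maximal_cfgs_split(1) using False by simp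
qed

lemma val_empty: "val {#} = (0, 0)"
  by (simp add: val_def)

text \<open>The empty multiset lies in every window, so by duality a nonempty one of value zero
  would have total cost at least \<open>2 * tot (Suc i)\<close> for all \<open>i\<close>, which is
  unbounded.\<close>

lemma val_zero_size:
  assumes "val M = (0, 0)"
  shows "size M = 0"
proof (rule ccontr)
  assume "size M \<noteq> 0"
  then have m: "1 \<le> int (size M)" by (cases "size M") auto
  let ?T = "msum (\<lambda>j. int (tot j)) M"
  define i where "i = nat ?T + 1"
  have "2 * int (tot (Suc i)) * int (size M) \<le> ?T"
    using cost_lower_bound(1)[of "\<lambda>j. int (tot j)" "{#}" i M] assms by (simp add: tot_rec val_empty)
  moreover have "2 * int (tot (Suc i)) * 1 \<le> 2 * int (tot (Suc i)) * int (size M)"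
    using m by (intro mult_left_mono) auto
  moreover have "cst (Suc (Suc (Suc (Suc i)))) \<le> 2 * tot (Suc i)"
    using cst_mono[of "Suc i"] by (simp add: tot_def)
  then have "int i \<le> 2 * int (tot (Suc i))" using cst_ge[of i] by linarith
  ultimately show False by (simp add: i_def)
qed

lemma chi_zero: "chi d1 d2 0 = 1"
proof -
  have "{p. admits d1 d2 0 p \<and> (\<forall>t. admits d1 d2 t p \<longrightarrow> t \<le> 0)} = {(0, 0)}"
    unfolding admits_iff using val_zero_size by (auto simp: val_empty fits_def)
  then show ?thesis by (simp add: chi_def)
qed

theorem mainTheorem2:
  fixes d1 d2 s :: nat
  shows "chi d1 d2 s =
    (if s \<le> d1 + d2 then 2 * min (min d1 d2) (min s (d1 + d2 - s)) + 1 else 0)"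
proof (cases "s = 0")
  case True
  then show ?thesis by (simp add: chi_zero)
next
  case False
  then have s: "s \<ge> 1" by simp
  have inj: "inj_on (\<lambda>x. val (wms x)) {x \<in> cfgs s. fit d1 d2 x \<and> \<not> fit_succ d1 d2 x}"
    by (rule inj_on_subset[OF val_wms_inj]) auto
  show ?thesis
    unfolding chi_def maximal_eq_image[OF s] card_image[OF inj] by (rule card_maximal_cfgs[OF s])
qed

end
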